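(* Let $X,Y,Z$ be real Hilbert spaces. Let $A:X\to X$ be $(m_A,L_A)$-strongly monotone Lipschitz, let $\mathcal S:C(\mathbb R_+;X)\to C(\mathbb R_+;X)$ be history-dependent with constants $(s_m)_{m\in\mathbb N}$, let $b:X\times Y\to\mathbb R$ be an $(M_b,\alpha_b)$-inf-sup bilinear form, let $\Lambda\subset Y$ be closed and convex with $0_Y\in\Lambda$, let $\pi:X\to Z$ be a continuous linear operator, and let $f\in C(\mathbb R_+;Z)$, $h\in C(\mathbb R_+;X)$. Then the problem of finding functions $u:\mathbb R_+\to X$ and $\lambda:\mathbb R_+\to\Lambda$ such that, for all $t\in\mathbb R_+$, $$(Au(t),v)_X+(\mathcal Su(t),v)_X+b(v,\lambda(t))=(f(t),\pi v)_Z\quad\forall v\in X,$$ $$b(u(t),\mu-\lambda(t))\le b(h(t),\mu-\lambda(t))\quad\forall\mu\in\Lambda,$$ has a unique solution $(u,\lambda)$. Moreover, the solution satisfies $(u,\lambda)\in C(\mathbb R_+;X\times\Lambda)$.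
   Context: $\mathbb R_+=[0,+\infty)$; $C(\mathbb R_+;E)$ is the set of continuous functions from $\mathbb R_+$ to $E$. In the problem, $u$ is understood to belong to $C(\mathbb R_+;X)$, the domain of $\mathcal S$, so that $\mathcal Su$ makes sense. - For $m_A,L_A>0$, $A:X\to X$ (possibly nonlinear) is called $(m_A,L_A)$-strongly monotone Lipschitz if $(Au-Av,u-v)_X\ge m_A\|u-v\|_X^2$ and $\|Au-Av\|_X\le L_A\|u-v\|_X$ for all $u,v\in X$. - $\mathcal S:C(\mathbb R_+;X)\to C(\mathbb R_+;X)$ is called history-dependent with constants $s_m\ge0$ ($m\in\mathbb N$) if for each $m\in\mathbb N$: $\|\mathcal Su_1(t)-\mathcal Su_2(t)\|_X\le s_m\int_0^t\|u_1(s)-u_2(s)\|_X\,ds$ for all $u_1,u_2\in C(\mathbb R_+;X)$, $t\in[0,m]$. - For $M_b,\alpha_b>0$, a bilinear form $b:X\times Y\to\mathbb R$ is called an $(M_b,\alpha_b)$-inf-sup bilinear form if $|b(v,\mu)|\le M_b\|v\|_X\|\mu\|_Y$ for all $v\in X,\mu\in Y$, and $\inf_{\mu\in Y,\mu\ne0_Y}\sup_{v\in X,v\ne0_X}\frac{b(v,\mu)}{\|v\|_X\|\mu\|_Y}\ge\alpha_b$. *)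

theory Defs
  imports "HOL-Analysis.Analysis"
begin

text \<open>
  A function on \<open>[0, \<infinity>)\<close> is an extensional function on \<^term>\<open>{0::real..}\<close>, so that equality of
  such functions is equality in HOL. The codomain \<open>E\<close> is a set, in order to cover both a whole
  space (\<^term>\<open>UNIV\<close>) and a subset of one.
\<close>

definition C_Rplus :: "'a::topological_space set \<Rightarrow> (real \<Rightarrow> 'a) set" where
  "C_Rplus E = {u \<in> {0..} \<rightarrow>\<^sub>E E. continuous_on {0..} u}"

definition strongly_monotone_Lipschitz ::
    "real \<Rightarrow> real \<Rightarrow> ('x::real_inner \<Rightarrow> 'x) \<Rightarrow> bool" where
  "strongly_monotone_Lipschitz m L A \<longleftrightarrow>
     m > 0 \<and> L > 0 \<and>
     (\<forall>u v. inner (A u - A v) (u - v) \<ge> m * (norm (u - v))\<^sup>2) \<and>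
     (\<forall>u v. norm (A u - A v) \<le> L * norm (u - v))"

definition history_dependent ::
    "(nat \<Rightarrow> real) \<Rightarrow> ((real \<Rightarrow> 'x::real_normed_vector) \<Rightarrow> (real \<Rightarrow> 'x)) \<Rightarrow> bool" where
  "history_dependent s S \<longleftrightarrow>
     S \<in> C_Rplus UNIV \<rightarrow> C_Rplus UNIV \<and>
     (\<forall>m. s m \<ge> 0 \<and>
       (\<forall>u\<^sub>1 \<in> C_Rplus UNIV. \<forall>u\<^sub>2 \<in> C_Rplus UNIV. \<forall>t \<in> {0..real m}.
          norm (S u\<^sub>1 t - S u\<^sub>2 t) \<le> s m * integral {0..t} (\<lambda>r. norm (u\<^sub>1 r - u\<^sub>2 r))))"

text \<open>
  The infimum and supremum are taken in \<^typ>\<open>ereal\<close>, which gives the usual conventions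
  \<open>inf \<emptyset> = \<infinity>\<close> and \<open>sup \<emptyset> = -\<infinity>\<close> when one of the spaces is trivial.
\<close>

definition inf_sup_bilinear ::
    "real \<Rightarrow> real \<Rightarrow> ('x::real_normed_vector \<Rightarrow> 'y::real_normed_vector \<Rightarrow> real) \<Rightarrow> bool" where
  "inf_sup_bilinear M \<alpha> b \<longleftrightarrow>
     M > 0 \<and> \<alpha> > 0 \<and> bilinear b \<and>
     (\<forall>v \<mu>. \<bar>b v \<mu>\<bar> \<le> M * norm v * norm \<mu>) \<and>
     (INF \<mu>\<in>{\<mu>. \<mu> \<noteq> 0}. SUP v\<in>{v. v \<noteq> 0}. ereal (b v \<mu> / (norm v * norm \<mu>))) \<ge> ereal \<alpha>"

definition is_solution ::
    "('x::real_inner \<Rightarrow> 'x) \<Rightarrow> ((real \<Rightarrow> 'x) \<Rightarrow> (real \<Rightarrow> 'x)) \<Rightarrow> ('x \<Rightarrow> 'y::real_inner \<Rightarrow> real) \<Rightarrow>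
     'y set \<Rightarrow> ('x \<Rightarrow> 'z::real_inner) \<Rightarrow> (real \<Rightarrow> 'z) \<Rightarrow> (real \<Rightarrow> 'x) \<Rightarrow>
     (real \<Rightarrow> 'x) \<Rightarrow> (real \<Rightarrow> 'y) \<Rightarrow> bool" where
  "is_solution A S b \<Lambda> \<pi> f h u l \<longleftrightarrow>
     u \<in> C_Rplus UNIV \<and> l \<in> {0..} \<rightarrow>\<^sub>E \<Lambda> \<and>
     (\<forall>t \<ge> 0.
        (\<forall>v. inner (A (u t)) v + inner (S u t) v + b v (l t) = inner (f t) (\<pi> v)) \<and>
        (\<forall>\<mu> \<in> \<Lambda>. b (u t) (\<mu> - l t) \<le> b (h t) (\<mu> - l t)))"

end

theory Submission imports Defs begin

text \<open>
  Riesz representation turns \<open>b\<close> into a bounded operator \<open>B : Y \<rightarrow> X\<close> with \<open>b v \<mu> = (v, B \<mu>)\<close>, and the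
  inf-sup condition says that \<open>B\<close> is bounded below by \<open>\<alpha>\<close>. With the history term frozen, the problem
  at time \<open>t\<close> is a stationary saddle point problem with data \<open>F = \<pi>* f(t) - S u(t)\<close> and \<open>H = h(t)\<close>;
  it is uniquely solvable and its solution is Lipschitz in \<open>(F, H)\<close>. The solution operator composed
  with \<open>S\<close> is therefore again history-dependent. On \<open>[0, m]\<close> a history-dependent operator with
  constant \<open>s\<close> halves the norm \<open>sup |u(t)| exp(- (2s + 1) t)\<close>, so it has a unique fixed point.
\<close>

section \<open>Projection, Riesz representation and adjoints in Hilbert space\<close>

text \<open>By the parallelogram law a minimizing sequence for the distance from \<open>x\<close> is
  Cauchy, since convexity keeps midpoints in \<open>K\<close>. Its limit is a nearest point, and a
  nearest point of a convex set satisfies the obtuse angle inequality.\<close>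

lemma closed_convex_projection_exists:
  fixes K :: "'a::{real_inner, complete_space} set"
  assumes "closed K" "convex K" "K \<noteq> {}"
  shows "\<exists>p\<in>K. \<forall>y\<in>K. inner (x - p) (y - p) \<le> 0"
proof -
  define D where "D = (INF y\<in>K. (dist x y)\<^sup>2)"
  have bdd: "bdd_below ((\<lambda>y. (dist x y)\<^sup>2) ` K)"
    by (rule bdd_belowI[where m = 0]) auto
  have D_le: "D \<le> (dist x y)\<^sup>2" if "y \<in> K" for y
    unfolding D_def using bdd that by (rule cINF_lower)
  have "\<exists>y\<in>K. (dist x y)\<^sup>2 < D + inverse (real (Suc n))" for n
  proof -
    have "(INF y\<in>K. (dist x y)\<^sup>2) < D + inverse (real (Suc n))"
      by (simp add: D_def)
    then show ?thesis
      using cINF_less_iff[OF assms(3) bdd] by blast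
  qed
  then obtain y where yK: "\<And>n. y n \<in> K"
    and y_lt: "\<And>n. (dist x (y n))\<^sup>2 < D + inverse (real (Suc n))"
    by metis
  have y_dist: "(dist (y i) (y j))\<^sup>2 \<le> 2 * inverse (real (Suc i)) + 2 * inverse (real (Suc j))" for i j
  proof -
    have "midpoint (y i) (y j) \<in> K"
      using assms(2) yK by (simp add: midpoint_def convexD_alt scaleR_add_right convexD)
    then have "D \<le> (norm (x - midpoint (y i) (y j)))\<^sup>2"
      using D_le by (simp add: dist_norm)
    \<comment> \<open>Parallelogram law for \<open>x - y i\<close> and \<open>x - y j\<close>. The
      midpoint term is at least \<open>4 * D\<close> and cancels the \<open>4 * D\<close> that
      \<open>y_lt\<close> contributes on the right.\<close>
    moreover have "(norm (y i - y j))\<^sup>2 + 4 * (norm (x - midpoint (y i) (y j)))\<^sup>2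
        = 2 * (norm (x - y i))\<^sup>2 + 2 * (norm (x - y j))\<^sup>2"
      by (simp add: power2_norm_eq_inner midpoint_def algebra_simps inner_commute)
    ultimately show ?thesis
      using y_lt[of i] y_lt[of j] by (simp add: dist_norm)
  qed
  have "Cauchy y"
  proof (rule metric_CauchyI)
    fix e :: real assume "e > 0"
    then obtain N where N: "inverse (real (Suc N)) < e\<^sup>2 / 4"
      using reals_Archimedean[of "e\<^sup>2 / 4"] by auto
    have "dist (y i) (y j) < e" if "i \<ge> N" "j \<ge> N" for i j
    proof -
      have "inverse (real (Suc i)) \<le> inverse (real (Suc N))"
        "inverse (real (Suc j)) \<le> inverse (real (Suc N))"
        using that by (auto intro!: le_imp_inverse_le)
      then have "(dist (y i) (y j))\<^sup>2 < e\<^sup>2"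
        using y_dist[of i j] N by linarith
      then show ?thesis
        using \<open>e > 0\<close> by (simp add: power_less_imp_less_base)
    qed
    then show "\<exists>M. \<forall>m\<ge>M. \<forall>n\<ge>M. dist (y m) (y n) < e"
      by blast
  qed
  then obtain p where p: "y \<longlonglongrightarrow> p"
    using Cauchy_convergent convergent_def by blast
  have "p \<in> K"
    using assms(1) yK p closed_sequentially by blast
  have "(dist x p)\<^sup>2 \<le> D"
  proof (rule LIMSEQ_le)
    show "(\<lambda>n. (dist x (y n))\<^sup>2) \<longlonglongrightarrow> (dist x p)\<^sup>2"
      using p by (intro tendsto_intros)
    show "(\<lambda>n. D + inverse (real (Suc n))) \<longlonglongrightarrow> D"
      using tendsto_add[OF tendsto_const LIMSEQ_inverse_real_of_nat, of D] by simp
    show "\<exists>N. \<forall>n\<ge>N. (dist x (y n))\<^sup>2 \<le> D + inverse (real (Suc n))"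
      using y_lt less_imp_le by blast
  qed
  then have "dist x p \<le> dist x z" if "z \<in> K" for z
    using D_le[OF that] by (meson order_trans power2_le_imp_le zero_le_dist)
  then show ?thesis
    using any_closest_point_dot[OF assms(2,1) \<open>p \<in> K\<close>] \<open>p \<in> K\<close> by blast
qed

text \<open>The representer is a multiple of the point \<open>z\<close> of least norm on the
  hyperplane where \<open>\<phi>\<close> equals 1: \<open>z\<close> is orthogonal to the kernel, and
  \<open>v - \<phi> v *\<^sub>R z\<close> lies in the kernel.\<close>

lemma Riesz_representation:
  fixes \<phi> :: "'a::{real_inner, complete_space} \<Rightarrow> real"
  assumes "bounded_linear \<phi>"
  shows "\<exists>w. \<forall>v. \<phi> v = inner v w"
proof (cases "\<forall>v. \<phi> v = 0")
  case True
  then show ?thesis by (intro exI[of _ 0]) simp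
next
  case False
  interpret bounded_linear \<phi> by fact
  obtain a where a: "\<phi> a \<noteq> 0"
    using False by blast
  let ?K = "{v. \<phi> v = 1}"
  have "closed ?K"
    by (intro closed_Collect_eq continuous_on_const linear_continuous_on assms)
  moreover have "convex ?K"
    by (auto simp: convex_def add scale)
  moreover have "a /\<^sub>R \<phi> a \<in> ?K"
    using a by (simp add: scale)
  ultimately obtain z where z: "\<phi> z = 1" "\<And>y. \<phi> y = 1 \<Longrightarrow> inner (0 - z) (y - z) \<le> 0"
    using closed_convex_projection_exists[of ?K 0] by blast
  \<comment> \<open>Both \<open>z + k\<close> and \<open>z - k\<close> stay in the hyperplane, so
    the obtuse angle inequality holds with either sign of \<open>k\<close>.\<close>
  have orth: "inner z k = 0" if "\<phi> k = 0" for k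
    using z(2)[of "z + k"] z(2)[of "z - k"] z(1) that
    by (simp add: add diff)
  have "z \<noteq> 0"
    using z(1) zero by auto
  have "\<phi> v = inner v (z /\<^sub>R inner z z)" for v
  proof -
    have "inner z (v - \<phi> v *\<^sub>R z) = 0"
      by (rule orth) (simp add: diff scale z(1))
    then show ?thesis
      using \<open>z \<noteq> 0\<close> by (simp add: inner_diff_right inner_commute field_simps)
  qed
  then show ?thesis by blast
qed

text \<open>Riesz gives \<open>T' y\<close> for each \<open>y\<close> separately; uniqueness of
  representers makes it linear, and testing with \<open>x = T' y\<close> transfers the bound of
  \<open>T\<close>.\<close>

lemma bounded_linear_adjoint_exists:
  fixes T :: "'a::{real_inner, complete_space} \<Rightarrow> 'b::real_inner"
  assumes "bounded_linear T"
  shows "\<exists>T'. bounded_linear T' \<and> (\<forall>x y. inner (T x) y = inner x (T' y))"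
proof -
  have "\<exists>w. \<forall>x. inner (T x) y = inner x w" for y
    using Riesz_representation[OF bounded_linear_inner_left_comp[OF assms]] .
  then obtain T' where T': "\<And>x y. inner (T x) y = inner x (T' y)"
    by metis
  obtain C where C: "\<And>x. norm (T x) \<le> norm x * C" "C > 0"
    using bounded_linear.pos_bounded[OF assms] by blast
  have "bounded_linear T'"
  proof (rule bounded_linear_intro[where K = C])
    show "T' (y + z) = T' y + T' z" for y z
      by (rule vector_eq_ldot[THEN iffD1]) (simp add: inner_add_right flip: T')
    show "T' (r *\<^sub>R y) = r *\<^sub>R T' y" for r y
      by (rule vector_eq_ldot[THEN iffD1]) (simp flip: T')
    show "norm (T' y) \<le> norm y * C" for y
    proof -
      have "norm (T' y) * norm (T' y) = inner (T (T' y)) y"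
        by (simp add: T' flip: power2_norm_eq_inner power2_eq_square)
      also have "\<dots> \<le> norm (T (T' y)) * norm y"
        by (rule norm_cauchy_schwarz)
      also have "\<dots> \<le> norm (T' y) * C * norm y"
        by (intro mult_right_mono C) simp
      finally show ?thesis
        using C(2) by (cases "T' y = 0") (auto simp: mult_ac)
    qed
  qed
  then show ?thesis using T' by blast
qed

section \<open>Variational inequalities for strongly monotone operators\<close>

text \<open>Solutions are the fixed points of
  \<open>x \<mapsto> P (x - \<rho> *\<^sub>R T x)\<close>, with \<open>P\<close> the projection onto
  \<open>K\<close>. For a suitable step size this map is a contraction of \<open>K\<close>, so
  Banach's theorem applies.\<close>

lemma strongly_monotone_variational_inequality:
  fixes T :: "'a::{real_inner, complete_space} \<Rightarrow> 'a"
  assumes T: "strongly_monotone_Lipschitz m L T"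
    and K: "closed K" "convex K" "K \<noteq> {}"
  shows "\<exists>x\<in>K. \<forall>y\<in>K. inner (T x) (y - x) \<ge> 0"
proof -
  have m: "m > 0" and L: "L > 0"
    and mono: "\<And>u v. inner (T u - T v) (u - v) \<ge> m * (norm (u - v))\<^sup>2"
    and lip: "\<And>u v. norm (T u - T v) \<le> L * norm (u - v)"
    using T by (auto simp: strongly_monotone_Lipschitz_def)
  obtain P where PK: "\<And>x. P x \<in> K" and P: "\<And>x y. y \<in> K \<Longrightarrow> inner (x - P x) (y - P x) \<le> 0"
    using closed_convex_projection_exists[OF K] by metis
  have P_nonexp: "norm (P x - P y) \<le> norm (x - y)" for x y
  proof -
    \<comment> \<open>Sum of the two obtuse angle inequalities, each tested with the projection of
      the other point.\<close>
    have "(norm (P x - P y))\<^sup>2 \<le> inner (x - y) (P x - P y)"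
      using P[OF PK[of y], of x] P[OF PK[of x], of y]
      by (simp add: power2_norm_eq_inner inner_diff_left inner_diff_right inner_commute)
    also have "\<dots> \<le> norm (x - y) * norm (P x - P y)"
      by (rule norm_cauchy_schwarz)
    finally show ?thesis
      by (cases "P x = P y") (auto simp: power2_eq_square)
  qed
  \<comment> \<open>This step minimizes the squared contraction factor
    \<open>1 - 2 * \<rho> * m + \<rho>\<^sup>2 * L\<^sup>2\<close>. The \<open>max 0\<close> covers
    the zero space, the only one where \<open>m\<close> can exceed \<open>L\<close>.\<close>
  define \<rho> where "\<rho> = m / L\<^sup>2"
  define c where "c = sqrt (max 0 (1 - m\<^sup>2 / L\<^sup>2))"
  have \<rho>: "\<rho> > 0" using m L by (simp add: \<rho>_def)
  have c: "0 \<le> c" "c < 1"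
    using m L by (auto simp: c_def max_def)
  have contr: "dist (P (x - \<rho> *\<^sub>R T x)) (P (y - \<rho> *\<^sub>R T y)) \<le> c * dist x y" for x y
  proof -
    let ?d = "x - y" and ?e = "T x - T y"
    have "(norm ?e)\<^sup>2 \<le> (L * norm ?d)\<^sup>2"
      by (intro power_mono lip) simp
    then have e: "\<rho>\<^sup>2 * (norm ?e)\<^sup>2 \<le> \<rho>\<^sup>2 * (L\<^sup>2 * (norm ?d)\<^sup>2)"
      by (intro mult_left_mono) (auto simp: power_mult_distrib)
    have "2 * \<rho> * (m * (norm ?d)\<^sup>2) \<le> 2 * \<rho> * inner ?e ?d"
      using \<rho> by (intro mult_left_mono mono) auto
    moreover have "(norm (?d - \<rho> *\<^sub>R ?e))\<^sup>2 = (norm ?d)\<^sup>2 - 2 * \<rho> * inner ?e ?d + \<rho>\<^sup>2 * (norm ?e)\<^sup>2"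
      unfolding power2_norm_eq_inner
      by (simp add: inner_diff_left inner_diff_right inner_commute power2_eq_square algebra_simps)
    ultimately have "(norm (?d - \<rho> *\<^sub>R ?e))\<^sup>2
        \<le> (norm ?d)\<^sup>2 - 2 * \<rho> * (m * (norm ?d)\<^sup>2) + \<rho>\<^sup>2 * (L\<^sup>2 * (norm ?d)\<^sup>2)"
      using e by linarith
    also have "\<dots> = (1 - m\<^sup>2 / L\<^sup>2) * (norm ?d)\<^sup>2"
      using L by (simp add: \<rho>_def field_simps power2_eq_square)
    also have "\<dots> \<le> c\<^sup>2 * (norm ?d)\<^sup>2"
      by (intro mult_right_mono) (auto simp: c_def)
    finally have "(norm (?d - \<rho> *\<^sub>R ?e))\<^sup>2 \<le> (c * norm ?d)\<^sup>2"
      unfolding power_mult_distrib .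
    then have "norm (?d - \<rho> *\<^sub>R ?e) \<le> c * norm ?d"
      by (rule power2_le_imp_le) (simp add: c(1))
    moreover have "(x - \<rho> *\<^sub>R T x) - (y - \<rho> *\<^sub>R T y) = ?d - \<rho> *\<^sub>R ?e"
      by (simp add: algebra_simps)
    ultimately show ?thesis
      using P_nonexp[of "x - \<rho> *\<^sub>R T x" "y - \<rho> *\<^sub>R T y"] unfolding dist_norm by (metis order_trans)
  qed
  have "\<exists>!x\<in>K. P (x - \<rho> *\<^sub>R T x) = x"
    using K contr PK c by (intro Banach_fix[where c = c]) (auto simp: complete_eq_closed)
  then obtain x where x: "x \<in> K" "P (x - \<rho> *\<^sub>R T x) = x"
    by blast
  \<comment> \<open>At the fixed point, the point minus its projection is
    \<open>- \<rho> *\<^sub>R T x\<close>, so the obtuse angle inequality is the claim up to the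
    factor \<open>\<rho>\<close>.\<close>
  have "inner (T x) (y - x) \<ge> 0" if "y \<in> K" for y
    using P[OF that, of "x - \<rho> *\<^sub>R T x"] \<rho> by (simp add: x(2) zero_le_mult_iff)
  then show ?thesis using x(1) by blast
qed

section \<open>Fixed points of history-dependent operators\<close>

lemma C_Rplus_continuous_on:
  assumes "u \<in> C_Rplus E" "S \<subseteq> {0..}"
  shows "continuous_on S u"
  using assms continuous_on_subset by (auto simp: C_Rplus_def)

lemma restrict_in_C_Rplus:
  assumes "continuous_on {0..} g" "\<And>t. t \<ge> 0 \<Longrightarrow> g t \<in> E"
  shows "(\<lambda>t\<in>{0..}. g t) \<in> C_Rplus E"
proof -
  have "continuous_on {0..} (\<lambda>t\<in>{0..}. g t)"
    by (rule continuous_on_eq[OF assms(1)]) simp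
  then show ?thesis
    using assms(2) by (simp add: C_Rplus_def)
qed

text \<open>Contraction in an exponentially weighted supremum norm, stated pointwise. Integrating
  the weight gains the factor \<open>1 / \<beta>\<close> with \<open>\<beta> = 2 * s m + 1\<close>,
  and \<open>s m / \<beta>\<close> is at most 1/2; the added 1 keeps \<open>\<beta>\<close> positive
  when \<open>s m = 0\<close>.\<close>

lemma history_dependent_exp_estimate:
  assumes T: "history_dependent s T"
    and u: "u\<^sub>1 \<in> C_Rplus UNIV" "u\<^sub>2 \<in> C_Rplus UNIV"
    and "B \<ge> 0"
    and B: "\<And>r. r \<in> {0..real m} \<Longrightarrow> norm (u\<^sub>1 r - u\<^sub>2 r) \<le> B * exp ((2 * s m + 1) * r)"
    and t: "t \<in> {0..real m}"
  shows "norm (T u\<^sub>1 t - T u\<^sub>2 t) \<le> B / 2 * exp ((2 * s m + 1) * t)"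
proof -
  define \<beta> where "\<beta> = 2 * s m + 1"
  have s: "s m \<ge> 0"
    using T by (simp add: history_dependent_def)
  then have \<beta>: "\<beta> > 0" "s m / \<beta> \<le> 1 / 2"
    by (auto simp: \<beta>_def field_simps)
  have cont: "continuous_on {0..t} u\<^sub>1" "continuous_on {0..t} u\<^sub>2"
    using u by (auto intro: C_Rplus_continuous_on)
  have I: "((\<lambda>r. B * exp (\<beta> * r)) has_integral (B / \<beta> * exp (\<beta> * t) - B / \<beta> * exp (\<beta> * 0))) {0..t}"
    using t \<beta> by (intro fundamental_theorem_of_calculus)
      (auto intro!: derivative_eq_intros simp flip: has_real_derivative_iff_has_vector_derivative)
  have "integral {0..t} (\<lambda>r. norm (u\<^sub>1 r - u\<^sub>2 r)) \<le> integral {0..t} (\<lambda>r. B * exp (\<beta> * r))"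
    using B t I by (intro integral_le integrable_continuous_interval continuous_intros cont)
      (auto simp: \<beta>_def)
  also have "\<dots> \<le> B / \<beta> * exp (\<beta> * t)"
    unfolding integral_unique[OF I] using \<beta> \<open>B \<ge> 0\<close> by simp
  finally have "s m * integral {0..t} (\<lambda>r. norm (u\<^sub>1 r - u\<^sub>2 r)) \<le> s m * (B / \<beta> * exp (\<beta> * t))"
    by (intro mult_left_mono s)
  also have "\<dots> = s m / \<beta> * (B * exp (\<beta> * t))"
    by simp
  also have "\<dots> \<le> 1 / 2 * (B * exp (\<beta> * t))"
    using \<beta> \<open>B \<ge> 0\<close> by (intro mult_right_mono) auto
  finally have "s m * integral {0..t} (\<lambda>r. norm (u\<^sub>1 r - u\<^sub>2 r)) \<le> B / 2 * exp (\<beta> * t)"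
    by simp
  moreover have "norm (T u\<^sub>1 t - T u\<^sub>2 t) \<le> s m * integral {0..t} (\<lambda>r. norm (u\<^sub>1 r - u\<^sub>2 r))"
    using T u t by (simp add: history_dependent_def)
  ultimately show ?thesis
    by (simp add: \<beta>_def)
qed

lemma history_dependent_funpow_in_C_Rplus:
  assumes "history_dependent s T" "u \<in> C_Rplus UNIV"
  shows "(T ^^ n) u \<in> C_Rplus UNIV"
  using assms by (induction n) (auto simp: history_dependent_def)

text \<open>Each iteration halves the weighted distance. On \<open>{0..real m}\<close> the weight
  lies between 1 and its value at \<open>m\<close>, so it can be absorbed into \<open>B\<close>,
  which depends on \<open>m\<close> but not on \<open>n\<close>.\<close>

lemma history_dependent_funpow_estimate:
  assumes T: "history_dependent s T"
    and u: "u\<^sub>1 \<in> C_Rplus UNIV" "u\<^sub>2 \<in> C_Rplus UNIV"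
  shows "\<exists>B\<ge>0. \<forall>n. \<forall>t\<in>{0..real m}. norm ((T ^^ n) u\<^sub>1 t - (T ^^ n) u\<^sub>2 t) \<le> B * (1/2) ^ n"
proof -
  define \<beta> where "\<beta> = 2 * s m + 1"
  have \<beta>: "\<beta> > 0"
    using T by (auto simp: history_dependent_def \<beta>_def intro: add_nonneg_pos)
  have "continuous_on {0..real m} (\<lambda>t. u\<^sub>1 t - u\<^sub>2 t)"
    using u by (intro continuous_intros) (auto intro: C_Rplus_continuous_on)
  then have "bounded ((\<lambda>t. u\<^sub>1 t - u\<^sub>2 t) ` {0..real m})"
    by (intro compact_imp_bounded compact_continuous_image) auto
  then obtain B where B: "B > 0" "\<And>t. t \<in> {0..real m} \<Longrightarrow> norm (u\<^sub>1 t - u\<^sub>2 t) \<le> B"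
    by (auto simp: bounded_pos)
  have est: "norm ((T ^^ n) u\<^sub>1 t - (T ^^ n) u\<^sub>2 t) \<le> B * (1/2) ^ n * exp (\<beta> * t)"
    if "t \<in> {0..real m}" for n t
    using that
  proof (induction n arbitrary: t)
    case 0
    have "B * 1 \<le> B * exp (\<beta> * t)"
      using B(1) \<beta> 0 by (intro mult_left_mono) auto
    then show ?case
      using B(2)[OF 0] by simp
  next
    case (Suc n)
    then show ?case
      using history_dependent_exp_estimate[OF T
          history_dependent_funpow_in_C_Rplus[OF T u(1), of n]
          history_dependent_funpow_in_C_Rplus[OF T u(2), of n], of "B * (1/2) ^ n" m t] B(1)
      by (simp add: \<beta>_def)
  qed
  have "norm ((T ^^ n) u\<^sub>1 t - (T ^^ n) u\<^sub>2 t) \<le> (B * exp (\<beta> * m)) * (1/2) ^ n"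
    if t: "t \<in> {0..real m}" for n t
  proof -
    have "exp (\<beta> * t) \<le> exp (\<beta> * m)"
      using t \<beta> by simp
    then have "B * (1/2) ^ n * exp (\<beta> * t) \<le> B * (1/2) ^ n * exp (\<beta> * m)"
      using B(1) by (intro mult_left_mono) auto
    then show ?thesis
      using est[OF t, of n] by (simp add: mult_ac)
  qed
  moreover have "B * exp (\<beta> * m) \<ge> 0"
    using B(1) by simp
  ultimately show ?thesis by blast
qed

lemma continuous_on_atLeast_if_all_intervals:
  fixes u :: "real \<Rightarrow> 'a::topological_space"
  assumes "\<And>m::nat. continuous_on {0..real m} u"
  shows "continuous_on {0..} u"
  unfolding continuous_on_def
proof
  fix t :: real assume t: "t \<in> {0..}"
  obtain m :: nat where m: "t < real m"
    using reals_Archimedean2 by blast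
  have "at t within {0..} = at t within {0..real m}"
    using m by (intro at_within_nhd[where S = "{..<real m}"]) auto
  then show "(u \<longlongrightarrow> u t) (at t within {0..})"
    using assms[of m] m t by (simp add: continuous_on_def)
qed

text \<open>The constants \<open>s m\<close> may grow with \<open>m\<close>, so no single weight is
  fixed on the half-line. Picard iterates do not depend on \<open>m\<close>, however, and they
  converge uniformly on every \<open>{0..real m}\<close>; their pointwise limit is therefore one
  continuous function on the half-line.\<close>

lemma history_dependent_fixed_point:
  fixes T :: "(real \<Rightarrow> 'a::{real_normed_vector, complete_space}) \<Rightarrow> (real \<Rightarrow> 'a)"
  assumes T: "history_dependent s T"
  shows "\<exists>!u. u \<in> C_Rplus UNIV \<and> T u = u"
proof (rule ex_ex1I)
  fix u v assume u: "u \<in> C_Rplus UNIV \<and> T u = u" and v: "v \<in> C_Rplus UNIV \<and> T v = v"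
  \<comment> \<open>Fixed points are their own iterates, so their distance at \<open>t\<close> is at
    most \<open>B * (1/2) ^ n\<close> for every \<open>n\<close>.\<close>
  have fix_n: "(T ^^ n) u = u" "(T ^^ n) v = v" for n
    using u v by (induction n) auto
  have "u t = v t" for t
  proof (cases "t \<ge> 0")
    case True
    obtain m :: nat where m: "t < real m"
      using reals_Archimedean2 by blast
    then have "t \<in> {0..real m}"
      using True by simp
    then obtain B where "\<And>n. norm (u t - v t) \<le> B * (1/2) ^ n"
      using history_dependent_funpow_estimate[OF T, of u v m] u v unfolding fix_n by blast
    moreover have "(\<lambda>n. B * (1/2) ^ n) \<longlonglongrightarrow> B * 0"
      by (intro tendsto_intros LIMSEQ_realpow_zero) auto
    ultimately have "norm (u t - v t) \<le> 0"
      by (intro LIMSEQ_le_const[where X = "\<lambda>n. B * (1/2) ^ n"]) auto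
    then show ?thesis by simp
  next
    \<comment> \<open>Outside the half-line extensionality forces both values to be
      \<open>undefined\<close>.\<close>
    case False
    then show ?thesis
      using u v by (auto simp: C_Rplus_def PiE_def extensional_def)
  qed
  then show "u = v" by blast
next
  define w :: "real \<Rightarrow> 'a" where "w = (\<lambda>t\<in>{0..}. 0)"
  define U where "U n = (T ^^ n) w" for n
  have w: "w \<in> C_Rplus UNIV"
    unfolding w_def by (rule restrict_in_C_Rplus) auto
  have U: "U n \<in> C_Rplus UNIV" for n
    unfolding U_def by (rule history_dependent_funpow_in_C_Rplus[OF T w])
  have rate: "\<exists>B\<ge>0. \<forall>n k. \<forall>t\<in>{0..real m}. norm (U n t - U (n + k) t) \<le> 2 * B * (1/2) ^ n" for m
  proof -
    \<comment> \<open>Comparing the iterates of \<open>w\<close> with those of \<open>T w\<close>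
      bounds the distance of consecutive Picard iterates.\<close>
    have "T w \<in> C_Rplus UNIV"
      using U[of 1] by (simp add: U_def)
    then obtain B where B: "B \<ge> 0"
      "\<And>n t. t \<in> {0..real m} \<Longrightarrow> norm ((T ^^ n) w t - (T ^^ n) (T w) t) \<le> B * (1/2) ^ n"
      using history_dependent_funpow_estimate[OF T w, of "T w" m] by blast
    have step: "norm (U n t - U (Suc n) t) \<le> B * (1/2) ^ n" if "t \<in> {0..real m}" for n t
      using B(2)[OF that, of n] unfolding U_def funpow_Suc_right by simp
    \<comment> \<open>The factor \<open>1 - (1/2) ^ k\<close> is the exact partial geometric sum;
      with it the induction on \<open>k\<close> closes.\<close>
    have "norm (U n t - U (n + k) t) \<le> 2 * B * (1/2) ^ n * (1 - (1/2) ^ k)"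
      if "t \<in> {0..real m}" for n k t
    proof (induction k)
      case (Suc k)
      have "norm (U n t - U (n + Suc k) t)
          \<le> norm (U n t - U (n + k) t) + norm (U (n + k) t - U (Suc (n + k)) t)"
        using norm_triangle_ineq[of "U n t - U (n + k) t" "U (n + k) t - U (Suc (n + k)) t"] by simp
      also have "\<dots> \<le> 2 * B * (1/2) ^ n * (1 - (1/2) ^ k) + B * (1/2) ^ (n + k)"
        by (intro add_mono Suc step that)
      also have "\<dots> = 2 * B * (1/2) ^ n * (1 - (1/2) ^ Suc k)"
        by (simp add: power_add algebra_simps)
      finally show ?case .
    qed simp
    moreover have "2 * B * (1/2) ^ n * (1 - (1/2) ^ k) \<le> 2 * B * (1/2) ^ n" for n k :: nat
      using B(1) by (intro mult_left_le) auto
    ultimately show ?thesis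
      using B(1) by (meson order_trans)
  qed
  have "uniformly_convergent_on {0..real m} U" for m
  proof (rule Cauchy_uniformly_convergent, rule uniformly_Cauchy_onI')
    fix e :: real assume "e > 0"
    obtain B where B: "\<And>n k t. t \<in> {0..real m} \<Longrightarrow> norm (U n t - U (n + k) t) \<le> 2 * B * (1/2) ^ n"
      using rate[of m] by blast
    have "(\<lambda>n. 2 * B * (1/2) ^ n) \<longlonglongrightarrow> 2 * B * 0"
      by (intro tendsto_intros LIMSEQ_realpow_zero) auto
    then have "\<forall>\<^sub>F n in sequentially. 2 * B * (1/2) ^ n < e"
      using \<open>e > 0\<close> by (intro order_tendstoD) auto
    then obtain N where N: "\<And>n. n \<ge> N \<Longrightarrow> 2 * B * (1/2) ^ n < e"
      by (auto simp: eventually_sequentially)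
    have "dist (U i t) (U j t) < e" if "t \<in> {0..real m}" "N \<le> i" "i < j" for t i j
      using B[OF that(1), of i "j - i"] N[of i] that by (simp add: dist_norm)
    then show "\<exists>M. \<forall>x\<in>{0..real m}. \<forall>i\<ge>M. \<forall>n>i. dist (U i x) (U n x) < e"
      by blast
  qed
  then have lim: "uniform_limit {0..real m} U (\<lambda>t. lim (\<lambda>n. U n t)) sequentially" for m
    by (simp add: uniformly_convergent_uniform_limit_iff)
  define u where "u = (\<lambda>t\<in>{0..}. lim (\<lambda>n. U n t))"
  have lim_u: "uniform_limit {0..real m} U u sequentially" for m
    using lim[of m] by (rule uniform_limit_cong'[THEN iffD1, rotated -1]) (auto simp: u_def)
  have "continuous_on {0..real m} u" for m
    using C_Rplus_continuous_on[OF U]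
    by (intro uniform_limit_theorem[OF _ lim_u] always_eventually allI) auto
  then have "continuous_on {0..} u"
    by (rule continuous_on_atLeast_if_all_intervals)
  then have u: "u \<in> C_Rplus UNIV"
    by (auto simp: C_Rplus_def u_def)
  then have Tu: "T u \<in> C_Rplus UNIV"
    using T by (auto simp: history_dependent_def)
  have "T u t = u t" for t
  proof (cases "t \<ge> 0")
    case True
    obtain m :: nat where m: "t < real m"
      using reals_Archimedean2 by blast
    then have tm: "t \<in> {0..real m}" using True by simp
    have "(\<lambda>n. U n t) \<longlonglongrightarrow> u t"
      using lim_u[of m] tm by (rule tendsto_uniform_limitI)
    then have "(\<lambda>n. U (Suc n) t) \<longlonglongrightarrow> u t"
      by (rule LIMSEQ_Suc)
    \<comment> \<open>\<open>T\<close> is continuous for uniform convergence on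
      \<open>{0..real m}\<close>, again by the exponential estimate.\<close>
    moreover have "(\<lambda>n. U (Suc n) t) \<longlonglongrightarrow> T u t"
    proof (rule LIMSEQ_I)
      fix e :: real assume "e > 0"
      define \<beta> where "\<beta> = 2 * s m + 1"
      have \<beta>: "\<beta> \<ge> 0"
        using T by (auto simp: history_dependent_def \<beta>_def)
      \<comment> \<open>Chosen so that the resulting bound \<open>d / 2 * exp (\<beta> * t)\<close>
        equals \<open>e / 2\<close>.\<close>
      define d where "d = e / exp (\<beta> * t)"
      have "d > 0" using \<open>e > 0\<close> by (simp add: d_def)
      then obtain N where N: "\<And>n r. n \<ge> N \<Longrightarrow> r \<in> {0..real m} \<Longrightarrow> dist (U n r) (u r) < d"
        using lim_u[of m] unfolding uniform_limit_sequentially_iff by blast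
      have "norm (U (Suc n) t - T u t) < e" if "n \<ge> N" for n
      proof -
        have "norm (U n r - u r) \<le> d * exp (\<beta> * r)" if r: "r \<in> {0..real m}" for r
        proof -
          have "d * 1 \<le> d * exp (\<beta> * r)"
            using \<open>d > 0\<close> \<beta> r by (intro mult_left_mono) auto
          then show ?thesis
            using N[OF \<open>n \<ge> N\<close> r] by (simp add: dist_norm)
        qed
        then have "norm (T (U n) t - T u t) \<le> d / 2 * exp (\<beta> * t)"
          unfolding \<beta>_def using \<open>d > 0\<close>
          by (intro history_dependent_exp_estimate[OF T U u _ _ tm]) auto
        also have "\<dots> < e"
          using \<open>e > 0\<close> by (simp add: d_def)
        finally show ?thesis
          by (simp add: U_def)
      qed
      then show "\<exists>N. \<forall>n\<ge>N. norm (U (Suc n) t - T u t) < e"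
        by blast
    qed
    ultimately show ?thesis
      using LIMSEQ_unique by blast
  next
    case False
    then show ?thesis
      using u Tu by (auto simp: C_Rplus_def PiE_def extensional_def)
  qed
  then show "\<exists>u. u \<in> C_Rplus UNIV \<and> T u = u"
    using u by blast
qed

section \<open>The stationary saddle point problem\<close>

text \<open>The problem at one instant: testing with all \<open>v\<close> becomes an equation in the
  space itself, and \<open>b\<close> enters only through its operator \<open>B\<close>. The data
  \<open>F\<close> and \<open>H\<close> are parameters so that solutions for different data can be
  compared.\<close>

definition saddle_point ::
    "('x::real_inner \<Rightarrow> 'x) \<Rightarrow> ('y::real_inner \<Rightarrow> 'x) \<Rightarrow> 'y set \<Rightarrow> 'x \<Rightarrow> 'x \<Rightarrow> 'x \<Rightarrow> 'y \<Rightarrow> bool" where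
  "saddle_point A B \<Lambda> F H u l \<longleftrightarrow>
     l \<in> \<Lambda> \<and> A u + B l = F \<and> (\<forall>\<mu>\<in>\<Lambda>. inner (u - H) (B (\<mu> - l)) \<le> 0)"

text \<open>The variational inequality for \<open>A - w\<close> on the whole space, tested with
  \<open>y = x - (A x - w)\<close>, makes the residual vanish.\<close>

lemma strongly_monotone_Lipschitz_surj:
  fixes A :: "'x::{real_inner, complete_space} \<Rightarrow> 'x"
  assumes "strongly_monotone_Lipschitz m L A"
  shows "surj A"
proof -
  have "\<exists>x. A x = w" for w
  proof -
    have "strongly_monotone_Lipschitz m L (\<lambda>x. A x - w)"
      using assms by (simp add: strongly_monotone_Lipschitz_def)
    then obtain x where "\<And>y. inner (A x - w) (y - x) \<ge> 0"
      using strongly_monotone_variational_inequality[of m L "\<lambda>x. A x - w" UNIV] by auto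
    from this[of "x - (A x - w)"] have "inner (A x - w) (- (A x - w)) \<ge> 0"
      by simp
    then have "A x - w = 0"
      unfolding inner_minus_right by (metis inner_gt_zero_iff neg_0_le_iff_le not_le)
    then have "A x = w"
      by simp
    then show ?thesis ..
  qed
  then show ?thesis
    by (metis surj_def)
qed

text \<open>Supplies the Lipschitz constant \<open>1 / m\<close> of the inverse of
  \<open>A\<close>.\<close>

lemma strongly_monotone_Lipschitz_expansive:
  assumes "strongly_monotone_Lipschitz m L A"
  shows "m * norm (u - v) \<le> norm (A u - A v)"
proof (cases "u = v")
  case False
  have "m * (norm (u - v))\<^sup>2 \<le> inner (A u - A v) (u - v)"
    using assms by (simp add: strongly_monotone_Lipschitz_def)
  also have "\<dots> \<le> norm (A u - A v) * norm (u - v)"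
    by (rule norm_cauchy_schwarz)
  finally show ?thesis
    using False by (simp add: power2_eq_square)
qed simp

text \<open>Eliminating \<open>u = A\<^sup>-\<^sup>1 (F - B l)\<close> leaves a variational inequality for \<open>l\<close> alone; its operator
  inherits strong monotonicity from \<open>A\<close> because \<open>B\<close> is bounded below.\<close>

lemma saddle_point_exists:
  fixes A :: "'x::{real_inner, complete_space} \<Rightarrow> 'x"
    and B :: "'y::{real_inner, complete_space} \<Rightarrow> 'x"
  assumes A: "strongly_monotone_Lipschitz m L A"
    and B: "bounded_linear B" "\<alpha> > 0" "\<And>\<mu>. \<alpha> * norm \<mu> \<le> norm (B \<mu>)"
    and \<Lambda>: "closed \<Lambda>" "convex \<Lambda>" "\<Lambda> \<noteq> {}"
  shows "\<exists>u l. saddle_point A B \<Lambda> F H u l"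
proof -
  have m: "m > 0" and L: "L > 0"
    and mono: "\<And>u v. m * (norm (u - v))\<^sup>2 \<le> inner (A u - A v) (u - v)"
    and lip: "\<And>u v. norm (A u - A v) \<le> L * norm (u - v)"
    using A by (auto simp: strongly_monotone_Lipschitz_def)
  interpret B: bounded_linear B by fact
  obtain B' where B': "bounded_linear B'" "\<And>x y. inner (B x) y = inner x (B' y)"
    using bounded_linear_adjoint_exists[OF B(1)] by blast
  interpret B': bounded_linear B' by fact
  obtain C where C: "C > 0" "\<And>x. norm (B x) \<le> norm x * C"
    using B.pos_bounded by blast
  obtain C' where C': "C' > 0" "\<And>x. norm (B' x) \<le> norm x * C'"
    using B'.pos_bounded by blast
  obtain G where G: "\<And>w. A (G w) = w"
    using strongly_monotone_Lipschitz_surj[OF A] by (metis surj_f_inv_f)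
  \<comment> \<open>With \<open>u = G (F - B l)\<close>, pairing \<open>T l\<close> with
    \<open>\<mu> - l\<close> gives minus the constraint expression, so the variational inequality
    for \<open>T\<close> is the constraint of the saddle point.\<close>
  define T where "T k = - B' (G (F - B k) - H)" for k
  have T_inner: "inner (T k) y = - inner (G (F - B k) - H) (B y)" for k y
    using B'(2)[of y "G (F - B k) - H"] by (simp add: T_def inner_commute)
  \<comment> \<open>Strong monotonicity combines \<open>m\<close> from \<open>A\<close> with the
    square of \<open>\<alpha> / L\<close>, since a change in \<open>l\<close> moves \<open>u\<close>
    by at least that ratio. The Lipschitz constant multiplies those of \<open>B\<close>, the inverse
    of \<open>A\<close>, and \<open>B'\<close>.\<close>
  have T: "strongly_monotone_Lipschitz (m * \<alpha>\<^sup>2 / L\<^sup>2) (C' * C / m) T"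
    unfolding strongly_monotone_Lipschitz_def
  proof (intro conjI allI)
    fix k \<mu>
    let ?u = "G (F - B k)" and ?v = "G (F - B \<mu>)"
    have dA: "A ?u - A ?v = - B (k - \<mu>)"
      by (simp add: G B.diff)
    have "\<alpha> * norm (k - \<mu>) \<le> L * norm (?u - ?v)"
      using B(3)[of "k - \<mu>"] lip[of ?u ?v] by (simp add: dA)
    then have "(\<alpha> * norm (k - \<mu>))\<^sup>2 \<le> (L * norm (?u - ?v))\<^sup>2"
      using B(2) by (intro power_mono) auto
    then have "\<alpha>\<^sup>2 / L\<^sup>2 * (norm (k - \<mu>))\<^sup>2 \<le> (norm (?u - ?v))\<^sup>2"
      using L by (simp add: power_mult_distrib field_simps)
    then have "m * (\<alpha>\<^sup>2 / L\<^sup>2 * (norm (k - \<mu>))\<^sup>2) \<le> m * (norm (?u - ?v))\<^sup>2"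
      using m by (intro mult_left_mono) auto
    also have "\<dots> \<le> inner (A ?u - A ?v) (?u - ?v)"
      by (rule mono)
    also have "\<dots> = inner (T k - T \<mu>) (k - \<mu>)"
      unfolding dA inner_diff_left[of "T k" "T \<mu>"] T_inner
      by (simp add: inner_diff_left inner_diff_right inner_commute)
    finally show "m * \<alpha>\<^sup>2 / L\<^sup>2 * (norm (k - \<mu>))\<^sup>2 \<le> inner (T k - T \<mu>) (k - \<mu>)"
      by simp
    have "T k - T \<mu> = - B' (?u - ?v)"
      by (simp add: T_def B'.diff)
    then have "norm (T k - T \<mu>) \<le> norm (?u - ?v) * C'"
      using C'(2)[of "?u - ?v"] by simp
    also have "m * norm (?u - ?v) \<le> C * norm (k - \<mu>)"
      using strongly_monotone_Lipschitz_expansive[OF A, of ?u ?v] C(2)[of "k - \<mu>"]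
      by (simp add: dA mult.commute)
    then have "norm (?u - ?v) \<le> C / m * norm (k - \<mu>)"
      using m by (simp add: field_simps)
    then have "norm (?u - ?v) * C' \<le> C / m * norm (k - \<mu>) * C'"
      using C'(1) by (intro mult_right_mono) auto
    finally show "norm (T k - T \<mu>) \<le> C' * C / m * norm (k - \<mu>)"
      by (simp add: mult_ac)
  qed (use m L B(2) C C' in auto)
  obtain l where l: "l \<in> \<Lambda>" "\<And>\<mu>. \<mu> \<in> \<Lambda> \<Longrightarrow> inner (T l) (\<mu> - l) \<ge> 0"
    using strongly_monotone_variational_inequality[OF T \<Lambda>] by blast
  then have "saddle_point A B \<Lambda> F H (G (F - B l)) l"
    by (simp add: saddle_point_def G T_inner)
  then show ?thesis by blast
qed

text \<open>The monotonicity of \<open>A\<close> and the two constraints give a quadratic inequality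
  for the distance of the \<open>u\<close> components; the equation and the lower bound on
  \<open>B\<close> then control the multipliers. Equal data give uniqueness, and \<open>K\<close> is
  independent of \<open>\<Lambda>\<close> and of the data.\<close>

lemma saddle_point_Lipschitz:
  fixes A :: "'x::real_inner \<Rightarrow> 'x" and B :: "'y::real_inner \<Rightarrow> 'x"
  assumes A: "strongly_monotone_Lipschitz m L A"
    and B: "bounded_linear B" "\<alpha> > 0" "\<And>\<mu>. \<alpha> * norm \<mu> \<le> norm (B \<mu>)"
  obtains K where "K \<ge> 0"
    "\<And>\<Lambda> F\<^sub>1 H\<^sub>1 u\<^sub>1 l\<^sub>1 F\<^sub>2 H\<^sub>2 u\<^sub>2 l\<^sub>2.
      saddle_point A B \<Lambda> F\<^sub>1 H\<^sub>1 u\<^sub>1 l\<^sub>1 \<Longrightarrow> saddle_point A B \<Lambda> F\<^sub>2 H\<^sub>2 u\<^sub>2 l\<^sub>2 \<Longrightarrow>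
      norm (u\<^sub>1 - u\<^sub>2) \<le> K * (norm (F\<^sub>1 - F\<^sub>2) + norm (H\<^sub>1 - H\<^sub>2)) \<and>
      norm (l\<^sub>1 - l\<^sub>2) \<le> K * (norm (F\<^sub>1 - F\<^sub>2) + norm (H\<^sub>1 - H\<^sub>2))"
proof -
  have m: "m > 0" and L: "L > 0"
    and mono: "\<And>u v. m * (norm (u - v))\<^sup>2 \<le> inner (A u - A v) (u - v)"
    and lip: "\<And>u v. norm (A u - A v) \<le> L * norm (u - v)"
    using A by (auto simp: strongly_monotone_Lipschitz_def)
  interpret B: bounded_linear B by fact
  \<comment> \<open>For \<open>x\<close> the distance of the \<open>u\<close> components and
    \<open>d\<close> that of the data, the value 1 serves the case \<open>x \<le> d\<close>.
    Otherwise one \<open>d\<close> in \<open>d * d\<close> is replaced by \<open>x\<close>, and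
    dividing by \<open>x\<close> leaves \<open>m * x \<le> (2 + L) * d\<close>.\<close>
  define K where "K = max 1 ((2 + L) / m)"
  have K: "K \<ge> 1" "2 + L \<le> K * m"
    using m by (auto simp: K_def max_def field_simps)
  have bounds: "norm (u\<^sub>1 - u\<^sub>2) \<le> K * (norm (F\<^sub>1 - F\<^sub>2) + norm (H\<^sub>1 - H\<^sub>2))"
    "\<alpha> * norm (l\<^sub>1 - l\<^sub>2) \<le> (1 + L * K) * (norm (F\<^sub>1 - F\<^sub>2) + norm (H\<^sub>1 - H\<^sub>2))"
    if sp: "saddle_point A B \<Lambda> F\<^sub>1 H\<^sub>1 u\<^sub>1 l\<^sub>1" "saddle_point A B \<Lambda> F\<^sub>2 H\<^sub>2 u\<^sub>2 l\<^sub>2"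
    for \<Lambda> F\<^sub>1 H\<^sub>1 u\<^sub>1 l\<^sub>1 F\<^sub>2 H\<^sub>2 u\<^sub>2 l\<^sub>2
  proof -
    let ?u = "u\<^sub>1 - u\<^sub>2" and ?F = "F\<^sub>1 - F\<^sub>2" and ?H = "H\<^sub>1 - H\<^sub>2" and ?A = "A u\<^sub>1 - A u\<^sub>2"
    define d where "d = norm ?F + norm ?H"
    define x where "x = norm ?u"
    have d: "norm ?F \<le> d" "norm ?H \<le> d" "0 \<le> d"
      by (auto simp: d_def)
    have x: "x \<ge> 0"
      by (simp add: x_def)
    have eq: "A u\<^sub>1 + B l\<^sub>1 = F\<^sub>1" "A u\<^sub>2 + B l\<^sub>2 = F\<^sub>2" and l: "l\<^sub>1 \<in> \<Lambda>" "l\<^sub>2 \<in> \<Lambda>"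
      using sp by (auto simp: saddle_point_def)
    have Bl: "B (l\<^sub>1 - l\<^sub>2) = ?F - ?A"
      by (simp add: B.diff flip: eq)
    have nBl: "norm (B (l\<^sub>1 - l\<^sub>2)) \<le> d + L * x"
      unfolding Bl using norm_triangle_ineq4[of ?F ?A] lip[of u\<^sub>1 u\<^sub>2] d(1) by (simp add: x_def)
    \<comment> \<open>Each constraint is tested with the multiplier of the other solution; the sum
      trades the coupling term in \<open>u\<close> for one in the data \<open>H\<close>.\<close>
    have "inner (u\<^sub>1 - H\<^sub>1) (B (l\<^sub>2 - l\<^sub>1)) \<le> 0" "inner (u\<^sub>2 - H\<^sub>2) (B (l\<^sub>1 - l\<^sub>2)) \<le> 0"
      using sp l by (auto simp: saddle_point_def)
    then have VI: "- inner ?u (B (l\<^sub>1 - l\<^sub>2)) \<le> - inner ?H (B (l\<^sub>1 - l\<^sub>2))"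
      by (simp add: B.diff inner_diff_left inner_diff_right)
    have "m * x\<^sup>2 \<le> inner ?A ?u"
      unfolding x_def by (rule mono)
    also have "\<dots> = inner ?F ?u - inner ?u (B (l\<^sub>1 - l\<^sub>2))"
      by (simp add: Bl inner_diff_right inner_commute)
    also have "\<dots> \<le> inner ?F ?u - inner ?H (B (l\<^sub>1 - l\<^sub>2))"
      using VI by linarith
    also have "\<dots> \<le> norm ?F * norm ?u + norm ?H * norm (B (l\<^sub>1 - l\<^sub>2))"
      using norm_cauchy_schwarz[of ?F ?u] Cauchy_Schwarz_ineq2[of ?H "B (l\<^sub>1 - l\<^sub>2)"] by linarith
    also have "\<dots> \<le> d * x + d * (d + L * x)"
      using d nBl x unfolding x_def by (intro add_mono mult_mono) auto
    finally have main: "m * x\<^sup>2 \<le> d * x + d * (d + L * x)" .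
    have xK: "x \<le> K * d"
    proof (cases "x \<le> d")
      case True
      then show ?thesis
        using mult_right_mono[OF K(1) d(3)] by linarith
    next
      case False
      then have "x > 0" using d(3) by linarith
      have "d * (d + L * x) \<le> d * (x + L * x)"
        using False d(3) by (intro mult_left_mono) auto
      then have "m * x * x \<le> (2 + L) * d * x"
        using main by (simp add: power2_eq_square algebra_simps)
      then have "m * x \<le> (2 + L) * d"
        using \<open>x > 0\<close> by simp
      also have "\<dots> \<le> K * m * d"
        using K(2) d(3) by (rule mult_right_mono)
      finally show ?thesis
        using m by (simp add: mult_ac)
    qed
    then show "norm ?u \<le> K * (norm ?F + norm ?H)"
      by (simp add: x_def d_def)
    have "\<alpha> * norm (l\<^sub>1 - l\<^sub>2) \<le> d + L * x"
      using B(3) nBl by (rule order_trans)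
    also have "\<dots> \<le> d + L * (K * d)"
      using xK L by (intro add_left_mono mult_left_mono) auto
    finally show "\<alpha> * norm (l\<^sub>1 - l\<^sub>2) \<le> (1 + L * K) * (norm ?F + norm ?H)"
      by (simp add: d_def algebra_simps)
  qed
  show thesis
  proof (rule that[of "max K ((1 + L * K) / \<alpha>)"])
    show "0 \<le> max K ((1 + L * K) / \<alpha>)"
      using K(1) by simp
    fix \<Lambda> F\<^sub>1 H\<^sub>1 u\<^sub>1 l\<^sub>1 F\<^sub>2 H\<^sub>2 u\<^sub>2 l\<^sub>2
    assume sp: "saddle_point A B \<Lambda> F\<^sub>1 H\<^sub>1 u\<^sub>1 l\<^sub>1" "saddle_point A B \<Lambda> F\<^sub>2 H\<^sub>2 u\<^sub>2 l\<^sub>2"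
    define d where "d = norm (F\<^sub>1 - F\<^sub>2) + norm (H\<^sub>1 - H\<^sub>2)"
    have d: "d \<ge> 0" by (simp add: d_def)
    have "norm (u\<^sub>1 - u\<^sub>2) \<le> K * d"
      using bounds(1)[OF sp] by (simp add: d_def)
    moreover have "norm (l\<^sub>1 - l\<^sub>2) \<le> (1 + L * K) / \<alpha> * d"
      using bounds(2)[OF sp] B(2) by (simp add: d_def field_simps)
    ultimately show "norm (u\<^sub>1 - u\<^sub>2) \<le> max K ((1 + L * K) / \<alpha>) * d \<and>
        norm (l\<^sub>1 - l\<^sub>2) \<le> max K ((1 + L * K) / \<alpha>) * d"
      using mult_right_mono[OF max.cobounded1[of K "(1 + L * K) / \<alpha>"] d]
        mult_right_mono[OF max.cobounded2[of "(1 + L * K) / \<alpha>" K] d] by linarith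
  qed
qed

section \<open>The operator of an inf-sup form\<close>

text \<open>By Cauchy-Schwarz the inner supremum at \<open>\<mu>\<close> is at most
  \<open>norm (B \<mu>) / norm \<mu>\<close>, so the inf-sup condition becomes a lower bound on
  \<open>B\<close>.\<close>

lemma inf_sup_bilinear_operator:
  fixes b :: "'x::{real_inner, complete_space} \<Rightarrow> 'y::real_inner \<Rightarrow> real"
  assumes b: "inf_sup_bilinear M \<alpha> b"
  obtains B where "bounded_linear B" "\<And>v \<mu>. b v \<mu> = inner v (B \<mu>)"
    "\<And>\<mu>. \<alpha> * norm \<mu> \<le> norm (B \<mu>)"
proof -
  have bil: "bilinear b" and bound: "\<And>v \<mu>. \<bar>b v \<mu>\<bar> \<le> M * norm v * norm \<mu>"
    and inf_sup: "ereal \<alpha> \<le> (INF \<mu>\<in>{\<mu>. \<mu> \<noteq> 0}. SUP v\<in>{v. v \<noteq> 0}. ereal (b v \<mu> / (norm v * norm \<mu>)))"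
    using b by (auto simp: inf_sup_bilinear_def)
  have "bounded_linear (\<lambda>v. b v \<mu>)" for \<mu>
    using bil bound[of _ \<mu>]
    by (intro bounded_linear.intro bounded_linear_axioms.intro exI[of _ "M * norm \<mu>"])
      (auto simp: bilinear_def mult_ac)
  then have "\<exists>w. \<forall>v. b v \<mu> = inner v w" for \<mu>
    by (rule Riesz_representation)
  then obtain B where B: "\<And>v \<mu>. b v \<mu> = inner v (B \<mu>)"
    by metis
  have "bounded_linear B"
  proof (rule bounded_linear_intro[where K = M])
    show "B (x + y) = B x + B y" for x y
      by (rule vector_eq_ldot[THEN iffD1]) (simp add: inner_add_right bilinear_radd[OF bil] flip: B)
    show "B (r *\<^sub>R x) = r *\<^sub>R B x" for r x
      by (rule vector_eq_ldot[THEN iffD1]) (simp add: bilinear_rmul[OF bil] flip: B)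
    show "norm (B x) \<le> norm x * M" for x
    proof (cases "B x = 0")
      case True
      then show ?thesis
        using b by (simp add: inf_sup_bilinear_def)
    next
      case False
      have "norm (B x) * norm (B x) = b (B x) x"
        by (simp add: B flip: power2_norm_eq_inner power2_eq_square)
      also have "\<dots> \<le> M * norm (B x) * norm x"
        using bound[of "B x" x] by linarith
      finally show ?thesis
        using False by (simp add: mult_ac)
    qed
  qed
  moreover have "\<alpha> * norm \<mu> \<le> norm (B \<mu>)" for \<mu>
  proof (cases "\<mu> = 0")
    case False
    have "ereal \<alpha> \<le> (SUP v\<in>{v. v \<noteq> 0}. ereal (b v \<mu> / (norm v * norm \<mu>)))"
      using inf_sup by (rule order_trans) (use False in \<open>auto intro: INF_lower\<close>)
    also have "\<dots> \<le> ereal (norm (B \<mu>) / norm \<mu>)"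
    proof (rule SUP_least)
      fix v :: 'x assume "v \<in> {v. v \<noteq> 0}"
      then show "ereal (b v \<mu> / (norm v * norm \<mu>)) \<le> ereal (norm (B \<mu>) / norm \<mu>)"
        using norm_cauchy_schwarz[of v "B \<mu>"] False by (simp add: B field_simps)
    qed
    finally show ?thesis
      using False by (simp add: field_simps)
  qed simp
  ultimately show thesis
    using that B by blast
qed

section \<open>The history-dependent problem on the half-line\<close>

text \<open>Turns the stability estimate, applied at two different times, into continuity in
  time.\<close>

lemma continuous_on_if_Lipschitz_in_data:
  fixes g :: "'a::topological_space \<Rightarrow> 'b::real_normed_vector"
    and F :: "'a \<Rightarrow> 'c::real_normed_vector" and H :: "'a \<Rightarrow> 'd::real_normed_vector"
  assumes "continuous_on S F" "continuous_on S H"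
    and g: "\<And>x y. x \<in> S \<Longrightarrow> y \<in> S \<Longrightarrow> norm (g x - g y) \<le> K * (norm (F x - F y) + norm (H x - H y))"
  shows "continuous_on S g"
  unfolding continuous_on_def
proof
  fix x assume x: "x \<in> S"
  have "((\<lambda>y. K * (norm (F y - F x) + norm (H y - H x))) \<longlongrightarrow>
      K * (norm (F x - F x) + norm (H x - H x))) (at x within S)"
    using assms(1,2) x by (intro tendsto_intros) (auto simp: continuous_on_def)
  then have "((\<lambda>y. K * (norm (F y - F x) + norm (H y - H x))) \<longlongrightarrow> 0) (at x within S)"
    by simp
  moreover have "\<forall>\<^sub>F y in at x within S. norm (g y - g x) \<le> K * (norm (F y - F x) + norm (H y - H x))"
    using g x unfolding eventually_at_topological by blast
  ultimately have "((\<lambda>y. g y - g x) \<longlongrightarrow> 0) (at x within S)"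
    by (rule Lim_null_comparison[rotated])
  then show "(g \<longlongrightarrow> g x) (at x within S)"
    by (simp add: Lim_null[symmetric])
qed

theorem proposition2p4:
  fixes A :: "'x::{real_inner, complete_space} \<Rightarrow> 'x"
    and S :: "(real \<Rightarrow> 'x) \<Rightarrow> (real \<Rightarrow> 'x)"
    and b :: "'x \<Rightarrow> 'y::{real_inner, complete_space} \<Rightarrow> real"
    and \<Lambda> :: "'y set"
    and \<pi> :: "'x \<Rightarrow> 'z::{real_inner, complete_space}"
    and f :: "real \<Rightarrow> 'z"
    and h :: "real \<Rightarrow> 'x"
    and m\<^sub>A L\<^sub>A M\<^sub>b \<alpha>\<^sub>b :: real
    and s :: "nat \<Rightarrow> real"
  assumes "strongly_monotone_Lipschitz m\<^sub>A L\<^sub>A A"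
    and "history_dependent s S"
    and "inf_sup_bilinear M\<^sub>b \<alpha>\<^sub>b b"
    and "closed \<Lambda>" and "convex \<Lambda>" and "0 \<in> \<Lambda>"
    and "bounded_linear \<pi>"
    and "f \<in> C_Rplus UNIV"
    and "h \<in> C_Rplus UNIV"
  shows "(\<exists>!(u, l). is_solution A S b \<Lambda> \<pi> f h u l) \<and>
    (\<forall>u l. is_solution A S b \<Lambda> \<pi> f h u l \<longrightarrow>
       (\<lambda>t\<in>{0..}. (u t, l t)) \<in> C_Rplus (UNIV \<times> \<Lambda>))"
proof -
  note A = assms(1) and S = assms(2)
  have \<alpha>: "\<alpha>\<^sub>b > 0"
    using assms(3) by (simp add: inf_sup_bilinear_def)
  obtain B where B: "bounded_linear B" "\<And>\<mu>. \<alpha>\<^sub>b * norm \<mu> \<le> norm (B \<mu>)"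
    and b: "\<And>v \<mu>. b v \<mu> = inner v (B \<mu>)"
    using inf_sup_bilinear_operator[OF assms(3)] by metis
  obtain \<pi>' where \<pi>': "bounded_linear \<pi>'" "\<And>v z. inner (\<pi> v) z = inner v (\<pi>' z)"
    using bounded_linear_adjoint_exists[OF assms(7)] by blast
  obtain K where K: "K \<ge> 0" and stab: "\<And>\<Lambda> F\<^sub>1 H\<^sub>1 u\<^sub>1 l\<^sub>1 F\<^sub>2 H\<^sub>2 u\<^sub>2 l\<^sub>2.
      saddle_point A B \<Lambda> F\<^sub>1 H\<^sub>1 u\<^sub>1 l\<^sub>1 \<Longrightarrow> saddle_point A B \<Lambda> F\<^sub>2 H\<^sub>2 u\<^sub>2 l\<^sub>2 \<Longrightarrow>
      norm (u\<^sub>1 - u\<^sub>2) \<le> K * (norm (F\<^sub>1 - F\<^sub>2) + norm (H\<^sub>1 - H\<^sub>2)) \<and>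
      norm (l\<^sub>1 - l\<^sub>2) \<le> K * (norm (F\<^sub>1 - F\<^sub>2) + norm (H\<^sub>1 - H\<^sub>2))"
    by (rule saddle_point_Lipschitz[OF A B(1) \<alpha> B(2)]) (rule that, assumption, blast)
  have "\<exists>u l. saddle_point A B \<Lambda> F H u l" for F H
    using saddle_point_exists[OF A B(1) \<alpha> B(2)] assms(4-6) by blast
  \<comment> \<open>Solution maps for arbitrary data; \<open>stab\<close> makes them Lipschitz and,
    for equal data, shows that no other solution exists.\<close>
  then obtain U V where UV: "\<And>F H. saddle_point A B \<Lambda> F H (U F H) (V F H)"
    by metis
  have unique: "u = U F H \<and> l = V F H" if "saddle_point A B \<Lambda> F H u l" for F H u l
    using stab[OF that UV[of F H]] by simp
  define F where "F u t = \<pi>' (f t) - S u t" for u t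
  have F_cont: "continuous_on {0..} (F u)" if "u \<in> C_Rplus UNIV" for u
  proof -
    have "S u \<in> C_Rplus UNIV"
      using S that by (auto simp: history_dependent_def)
    then show ?thesis
      unfolding F_def using assms(8)
      by (intro continuous_intros bounded_linear.continuous_on[OF \<pi>'(1)])
        (auto intro: C_Rplus_continuous_on)
  qed
  have h_cont: "continuous_on {0..} h"
    using assms(9) by (auto intro: C_Rplus_continuous_on)
  have sol_iff: "is_solution A S b \<Lambda> \<pi> f h u l \<longleftrightarrow>
      u \<in> C_Rplus UNIV \<and> l \<in> {0..} \<rightarrow>\<^sub>E \<Lambda> \<and> (\<forall>t\<ge>0. saddle_point A B \<Lambda> (F u t) (h t) (u t) (l t))"
    for u l
  proof -
    have "(\<forall>v. inner (A (u t)) v + inner (S u t) v + b v (l t) = inner (f t) (\<pi> v)) \<longleftrightarrow>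
        A (u t) + B (l t) = F u t" for t
    proof -
      have "(inner (A (u t)) v + inner (S u t) v + b v (l t) = inner (f t) (\<pi> v)) \<longleftrightarrow>
          inner v (A (u t) + B (l t)) = inner v (F u t)" for v
        using \<pi>'(2)[of v "f t"]
        by (simp add: b F_def inner_add_right inner_diff_right inner_commute algebra_simps)
      then show ?thesis
        by (simp add: vector_eq_ldot)
    qed
    then show ?thesis
      unfolding is_solution_def saddle_point_def
      by (auto simp: b inner_diff_left)
  qed
  \<comment> \<open>One step solves the problem at each time with the history term frozen at
    \<open>u\<close>; the restriction keeps the result extensional.\<close>
  define T where "T u = (\<lambda>t\<in>{0..}. U (F u t) (h t))" for u
  have T: "history_dependent (\<lambda>m. K * s m) T"
    unfolding history_dependent_def
  proof (intro conjI allI ballI)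
    show "T \<in> C_Rplus UNIV \<rightarrow> C_Rplus UNIV"
    proof
      fix u :: "real \<Rightarrow> 'x" assume "u \<in> C_Rplus UNIV"
      then have "continuous_on {0..} (\<lambda>t. U (F u t) (h t))"
        using stab[OF UV UV]
        by (intro continuous_on_if_Lipschitz_in_data[OF F_cont h_cont, where K = K]) auto
      then show "T u \<in> C_Rplus UNIV"
        unfolding T_def by (rule restrict_in_C_Rplus) simp
    qed
    fix m
    show "0 \<le> K * s m"
      using K S by (simp add: history_dependent_def)
    fix u\<^sub>1 u\<^sub>2 :: "real \<Rightarrow> 'x" and t
    assume u: "u\<^sub>1 \<in> C_Rplus UNIV" "u\<^sub>2 \<in> C_Rplus UNIV" and t: "t \<in> {0..real m}"
    \<comment> \<open>Both problems share \<open>f t\<close> and \<open>h t\<close>, so their data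
      differ only in the history term.\<close>
    have "norm (T u\<^sub>1 t - T u\<^sub>2 t) \<le> K * norm (S u\<^sub>1 t - S u\<^sub>2 t)"
      using stab[OF UV[of "F u\<^sub>1 t" "h t"] UV[of "F u\<^sub>2 t" "h t"]] t
      by (simp add: T_def F_def norm_minus_commute)
    also have "\<dots> \<le> K * (s m * integral {0..t} (\<lambda>r. norm (u\<^sub>1 r - u\<^sub>2 r)))"
      using S u t K by (intro mult_left_mono) (auto simp: history_dependent_def)
    finally show "norm (T u\<^sub>1 t - T u\<^sub>2 t) \<le> K * s m * integral {0..t} (\<lambda>r. norm (u\<^sub>1 r - u\<^sub>2 r))"
      by simp
  qed
  \<comment> \<open>The multiplier is determined by \<open>u\<close>, so uniqueness of the pair
    reduces to uniqueness of the fixed point.\<close>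
  have sol_T: "is_solution A S b \<Lambda> \<pi> f h u l \<longleftrightarrow>
      u \<in> C_Rplus UNIV \<and> T u = u \<and> l = (\<lambda>t\<in>{0..}. V (F u t) (h t))" for u l
  proof
    assume sol: "is_solution A S b \<Lambda> \<pi> f h u l"
    then have u: "u \<in> C_Rplus UNIV" and l: "l \<in> {0..} \<rightarrow>\<^sub>E \<Lambda>"
      and eq: "\<And>t. t \<ge> 0 \<Longrightarrow> u t = U (F u t) (h t) \<and> l t = V (F u t) (h t)"
      using unique by (auto simp: sol_iff)
    have "T u = u"
      using u eq by (intro ext) (auto simp: T_def C_Rplus_def PiE_def extensional_def)
    moreover have "l = (\<lambda>t\<in>{0..}. V (F u t) (h t))"
      using l eq by (intro ext) (auto simp: PiE_def extensional_def)
    ultimately show "u \<in> C_Rplus UNIV \<and> T u = u \<and> l = (\<lambda>t\<in>{0..}. V (F u t) (h t))"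
      using u by blast
  next
    assume *: "u \<in> C_Rplus UNIV \<and> T u = u \<and> l = (\<lambda>t\<in>{0..}. V (F u t) (h t))"
    have "V F' H \<in> \<Lambda>" for F' H
      using UV by (auto simp: saddle_point_def)
    moreover have "saddle_point A B \<Lambda> (F u t) (h t) (u t) (l t)" if "t \<ge> 0" for t
    proof -
      have "u t = T u t"
        using * by simp
      then show ?thesis
        using UV[of "F u t" "h t"] * that by (simp add: T_def)
    qed
    ultimately show "is_solution A S b \<Lambda> \<pi> f h u l"
      using * by (auto simp: sol_iff)
  qed
  have "\<exists>!(u, l). is_solution A S b \<Lambda> \<pi> f h u l"
  proof -
    obtain u where u: "u \<in> C_Rplus UNIV" "T u = u"
      and u_unique: "\<And>v. v \<in> C_Rplus UNIV \<Longrightarrow> T v = v \<Longrightarrow> v = u"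
      using history_dependent_fixed_point[OF T] by metis
    show ?thesis
    proof (rule ex1I)
      show "case (u, \<lambda>t\<in>{0..}. V (F u t) (h t)) of (u, l) \<Rightarrow> is_solution A S b \<Lambda> \<pi> f h u l"
        using u by (simp add: sol_T)
      fix p assume "case p of (u, l) \<Rightarrow> is_solution A S b \<Lambda> \<pi> f h u l"
      then obtain v where v: "v \<in> C_Rplus UNIV" "T v = v"
        and p: "p = (v, \<lambda>t\<in>{0..}. V (F v t) (h t))"
        by (cases p) (simp add: sol_T)
      show "p = (u, \<lambda>t\<in>{0..}. V (F u t) (h t))"
        unfolding p u_unique[OF v] ..
    qed
  qed
  moreover have "(\<lambda>t\<in>{0..}. (u t, l t)) \<in> C_Rplus (UNIV \<times> \<Lambda>)"
    if "is_solution A S b \<Lambda> \<pi> f h u l" for u l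
  proof -
    have u: "u \<in> C_Rplus UNIV" and l: "l \<in> {0..} \<rightarrow>\<^sub>E \<Lambda>"
      and sp: "\<And>t. t \<ge> 0 \<Longrightarrow> saddle_point A B \<Lambda> (F u t) (h t) (u t) (l t)"
      using that by (auto simp: sol_iff)
    \<comment> \<open>A solution is only required to have \<open>l\<close> with values in
      \<open>\<Lambda>\<close>; its continuity comes from comparing the stationary problems at two
      times.\<close>
    have "continuous_on {0..} l"
      using stab[OF sp sp]
      by (intro continuous_on_if_Lipschitz_in_data[OF F_cont[OF u] h_cont, where K = K]) auto
    then show ?thesis
      using u l by (intro restrict_in_C_Rplus continuous_intros) (auto intro: C_Rplus_continuous_on)
  qed
  ultimately show ?thesis
    by (intro conjI allI impI)
qed

end
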